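(* Let $U\subset\mathbb{R}^V$ be a graph shift-invariant space. Then $\mathbf{S}_1\cdots\mathbf{S}_dU$ is the maximal shift-invariant subspace $W$ of $U$ satisfying $$\mathbf{S}_lW=W,\quad 1\le l\le d;$$ that is, $\mathbf{S}_1\cdots\mathbf{S}_dU$ is a shift-invariant subspace of $U$ satisfying these equalities, and if $W$ is any shift-invariant subspace of $U$ satisfying these equalities, then $W\subset\mathbf{S}_1\cdots\mathbf{S}_dU$.
   Context: Let $\mathcal{G}=(V,E,\mathbf{W})$ be a finite, simple, undirected graph with $N\ge 2$ vertices. A graph signal is a vector in $\mathbb{R}^V$. A graph shift is a matrix $\mathbf{S}=[s(i,j)]_{i,j\in V}$ with $s(i,j)=0$ unless $i=j$ or $(i,j)\in E$. Standing assumption: $\mathbf{S}_1,\ldots,\mathbf{S}_d$ are graph shifts that are real-valued, symmetric and pairwise commuting. A graph shift-invariant space is a linear space $U$ of graph signals such that $\mathbf{S}_l\mathbf{x}\in U$ for all $1\le l\le d$ and $\mathbf{x}\in U$; a shift-invariant subspace of $U$ is a linear subspace of $U$ that is itself shift-invariant. For a matrix $\mathbf{A}$, $\mathbf{A}U=\{\mathbf{A}\mathbf{x}:\mathbf{x}\in U\}$. *)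

theory Defs
  imports "HOL-Analysis.Analysis"
begin

text \<open>
  The vertex set V is the universe of a finite type \<open>'v\<close>, so graph signals have type
  \<open>real ^ 'v\<close>.
\<close>

record ('v::finite) weighted_graph =
  edges :: "('v \<times> 'v) set"
  weights :: "real ^ 'v ^ 'v"

text \<open>
  Each undirected edge is stored as both ordered pairs. No condition is imposed on the weight
  matrix, since graph shifts depend on the edge set only.
\<close>

definition simple_undirected :: "'v::finite weighted_graph \<Rightarrow> bool" where
  "simple_undirected G \<longleftrightarrow> sym (edges G) \<and> irrefl (edges G)"

definition graph_shift :: "'v::finite weighted_graph \<Rightarrow> real ^ 'v ^ 'v \<Rightarrow> bool" where
  "graph_shift G A \<longleftrightarrow> (\<forall>i j. i \<noteq> j \<and> (i, j) \<notin> edges G \<longrightarrow> A $ i $ j = 0)"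

text \<open>
  A family of shifts is a function on the natural numbers, used only at the indices
  \<open>1, \<dots>, d\<close>.
\<close>

definition commuting_symmetric_shifts ::
    "'v::finite weighted_graph \<Rightarrow> nat \<Rightarrow> (nat \<Rightarrow> real ^ 'v ^ 'v) \<Rightarrow> bool" where
  "commuting_symmetric_shifts G d S \<longleftrightarrow>
     (\<forall>l\<in>{1..d}. graph_shift G (S l) \<and> transpose (S l) = S l) \<and>
     (\<forall>l\<in>{1..d}. \<forall>m\<in>{1..d}. S l ** S m = S m ** S l)"

definition shift_invariant_space ::
    "nat \<Rightarrow> (nat \<Rightarrow> real ^ 'v::finite ^ 'v) \<Rightarrow> (real ^ 'v) set \<Rightarrow> bool" where
  "shift_invariant_space d S U \<longleftrightarrow> subspace U \<and> (\<forall>l\<in>{1..d}. \<forall>x\<in>U. S l *v x \<in> U)"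

definition shift_invariant_subspace_of ::
    "nat \<Rightarrow> (nat \<Rightarrow> real ^ 'v::finite ^ 'v) \<Rightarrow> (real ^ 'v) set \<Rightarrow> (real ^ 'v) set \<Rightarrow> bool" where
  "shift_invariant_subspace_of d S U W \<longleftrightarrow> W \<subseteq> U \<and> shift_invariant_space d S W"

definition matrix_image :: "real ^ 'v::finite ^ 'v \<Rightarrow> (real ^ 'v) set \<Rightarrow> (real ^ 'v) set" where
  "matrix_image A U = {A *v x | x. x \<in> U}"

primrec shift_product :: "(nat \<Rightarrow> real ^ 'v::finite ^ 'v) \<Rightarrow> nat \<Rightarrow> real ^ 'v ^ 'v" where
  "shift_product S 0 = mat 1"
| "shift_product S (Suc d) = shift_product S d ** S (Suc d)"

end

theory Submission
  imports Defs
begin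

text \<open>
  A symmetric matrix is injective on its own range, since its kernel is orthogonal to its range.
  By commutativity each \<open>S\<^sub>l\<close> can be moved to the front of the product, so the image of \<open>U\<close> under
  \<open>S\<^sub>1\<cdots>S\<^sub>d\<close> lies in the range of \<open>S\<^sub>l\<close>; being invariant and finite-dimensional, it is
  mapped onto itself. Conversely, \<open>S\<^sub>l W = W\<close> for all \<open>l\<close> gives
  \<open>W = S\<^sub>1\<cdots>S\<^sub>d W \<subseteq> S\<^sub>1\<cdots>S\<^sub>d U\<close>.
\<close>

lemma matrix_image_eq_image: "matrix_image A U = (*v) A ` U"
  unfolding matrix_image_def by blast

lemma matrix_image_mult: "matrix_image (A ** B) U = matrix_image A (matrix_image B U)"
  by (simp add: matrix_image_eq_image image_image matrix_vector_mul_assoc)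

lemma matrix_image_mono: "U \<subseteq> V \<Longrightarrow> matrix_image A U \<subseteq> matrix_image A V"
  unfolding matrix_image_def by blast

text \<open>Symmetry moves one factor \<open>A\<close> across the inner product, so the squared norm
  of \<open>A *v x\<close> equals \<open>(A *v (A *v x)) \<bullet> x\<close>.\<close>

lemma symmetric_matrix_kernel_square:
  fixes A :: "real ^ 'n::finite ^ 'n"
  assumes "transpose A = A" and "A *v (A *v x) = 0"
  shows "A *v x = 0"
proof -
  have "(A *v x) \<bullet> (A *v x) = (A *v (A *v x)) \<bullet> x"
    by (metis assms(1) dot_lmul_matrix transpose_matrix_vector)
  with assms(2) show ?thesis
    by simp
qed

text \<open>By \<open>range\<close>, a difference of two points of \<open>V\<close> has the form
  \<open>A *v z\<close>; if \<open>A\<close> kills it, the kernel lemma makes it zero. Injectivity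
  preserves dimension, so the image, a subspace of \<open>V\<close> of full dimension, fills
  \<open>V\<close>.\<close>

lemma symmetric_matrix_image_eq:
  fixes A :: "real ^ 'n::finite ^ 'n"
  assumes sym: "transpose A = A" and V: "subspace V"
    and invariant: "(*v) A ` V \<subseteq> V" and range: "V \<subseteq> range ((*v) A)"
  shows "(*v) A ` V = V"
proof -
  have "inj_on ((*v) A) V"
  proof (rule inj_onI)
    fix x y assume xy: "x \<in> V" "y \<in> V" "A *v x = A *v y"
    then obtain x' y' where "x = A *v x'" "y = A *v y'"
      using range by blast
    with xy have "A *v (A *v (x' - y')) = 0"
      by (simp add: matrix_vector_mult_diff_distrib)
    from symmetric_matrix_kernel_square[OF sym this] show "x = y"
      by (simp add: \<open>x = _\<close> \<open>y = _\<close> matrix_vector_mult_diff_distrib)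
  qed
  then have "dim ((*v) A ` V) = dim V"
    using V by (intro dim_image_eq) (simp_all add: span_eq_iff[THEN iffD2])
  then show ?thesis
    using V invariant
    by (intro subspace_dim_equal) (simp_all add: linear_subspace_image)
qed

lemma shift_product_commute:
  fixes A :: "real ^ 'n::finite ^ 'n"
  assumes "\<And>l. l \<in> {1..n} \<Longrightarrow> A ** S l = S l ** A"
  shows "A ** shift_product S n = shift_product S n ** A"
  using assms
proof (induction n)
  case (Suc n)
  then have "A ** shift_product S n = shift_product S n ** A" "A ** S (Suc n) = S (Suc n) ** A"
    by simp_all
  then show ?case
    by (metis matrix_mul_assoc shift_product.simps(2))
qed simp

text \<open>Serves to place the image of the product inside the range of \<open>S l\<close>. A
  factor other than the last already comes to the front in the shorter product.\<close>

lemma shift_product_left_factor: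
  assumes "\<And>i j. i \<in> {1..n} \<Longrightarrow> j \<in> {1..n} \<Longrightarrow> S i ** S j = S j ** S i" and "l \<in> {1..n}"
  shows "\<exists>Q. shift_product S n = S l ** Q"
  using assms
proof (induction n)
  case (Suc n)
  show ?case
  proof (cases "l = Suc n")
    case True
    \<comment> \<open>The last factor passes all earlier ones, so \<open>shift_product S n\<close>
      itself serves as \<open>Q\<close>.\<close>
    have "S l ** shift_product S n = shift_product S n ** S l"
      using Suc.prems by (intro shift_product_commute) simp
    then show ?thesis
      using True by (metis shift_product.simps(2))
  next
    case False
    then have "\<exists>Q. shift_product S n = S l ** Q"
      using Suc.prems by (intro Suc.IH) auto
    then show ?thesis
      by (metis matrix_mul_assoc shift_product.simps(2))
  qed
qed simp

text \<open>The last factor acts first and keeps \<open>U\<close> inside itself; the shorter product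
  then does the same by induction.\<close>

lemma shift_product_image_subset:
  assumes "\<And>l. l \<in> {1..n} \<Longrightarrow> matrix_image (S l) U \<subseteq> U"
  shows "matrix_image (shift_product S n) U \<subseteq> U"
  using assms
proof (induction n)
  case 0
  show ?case by (simp add: matrix_image_def)
next
  case (Suc n)
  have "matrix_image (shift_product S (Suc n)) U \<subseteq> matrix_image (shift_product S n) U"
    using Suc.prems[of "Suc n"] by (simp add: matrix_image_mult matrix_image_mono)
  also have "\<dots> \<subseteq> U"
    using Suc by simp
  finally show ?case .
qed

lemma shift_product_image_eq:
  assumes "\<And>l. l \<in> {1..n} \<Longrightarrow> matrix_image (S l) W = W"
  shows "matrix_image (shift_product S n) W = W"
  using assms by (induction n) (simp_all add: matrix_image_mult, simp add: matrix_image_def)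

theorem theorem3p16:
  fixes G :: "'v::finite weighted_graph"
    and S :: "nat \<Rightarrow> real ^ 'v ^ 'v"
    and d :: nat
    and U :: "(real ^ 'v) set"
  assumes "CARD('v) \<ge> 2"
    and "simple_undirected G"
    and "d \<ge> 1"
    and "commuting_symmetric_shifts G d S"
    and "shift_invariant_space d S U"
  shows "shift_invariant_subspace_of d S U (matrix_image (shift_product S d) U) \<and>
    (\<forall>l\<in>{1..d}. matrix_image (S l) (matrix_image (shift_product S d) U)
                    = matrix_image (shift_product S d) U) \<and>
    (\<forall>W. shift_invariant_subspace_of d S U W \<and> (\<forall>l\<in>{1..d}. matrix_image (S l) W = W)
         \<longrightarrow> W \<subseteq> matrix_image (shift_product S d) U)"
proof (intro conjI)
  let ?P = "shift_product S d"
  let ?V = "matrix_image ?P U"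
  have sym: "transpose (S l) = S l" if "l \<in> {1..d}" for l
    using assms(4) that by (simp add: commuting_symmetric_shifts_def)
  have comm: "S l ** S m = S m ** S l" if "l \<in> {1..d}" "m \<in> {1..d}" for l m
    using assms(4) that by (simp add: commuting_symmetric_shifts_def)
  have U_inv: "matrix_image (S l) U \<subseteq> U" if "l \<in> {1..d}" for l
    using assms(5) that by (auto simp: shift_invariant_space_def matrix_image_def)
  have "subspace U"
    using assms(5) by (simp add: shift_invariant_space_def)
  then have V: "subspace ?V"
    by (simp add: matrix_image_eq_image linear_subspace_image)
  have V_inv: "matrix_image (S l) ?V \<subseteq> ?V" if "l \<in> {1..d}" for l
  proof -
    \<comment> \<open>Sliding \<open>S l\<close> past \<open>?P\<close> lets it act on
      \<open>U\<close> directly, where invariance is known.\<close>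
    have "S l ** ?P = ?P ** S l"
      using comm that by (intro shift_product_commute)
    then have "matrix_image (S l) ?V = matrix_image ?P (matrix_image (S l) U)"
      by (simp flip: matrix_image_mult)
    also have "\<dots> \<subseteq> ?V"
      using U_inv[OF that] by (rule matrix_image_mono)
    finally show ?thesis .
  qed
  have "S l *v x \<in> ?V" if "l \<in> {1..d}" "x \<in> ?V" for l x
    using V_inv[OF that(1)] that(2) unfolding matrix_image_def[of "S l"] by blast
  then show "shift_invariant_subspace_of d S U ?V"
    using V shift_product_image_subset[of d S U, OF U_inv]
    by (simp add: shift_invariant_subspace_of_def shift_invariant_space_def)
  show "\<forall>l\<in>{1..d}. matrix_image (S l) ?V = ?V"
  proof
    fix l assume l: "l \<in> {1..d}"
    obtain Q where "?P = S l ** Q"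
      using shift_product_left_factor[of d S l, OF comm l] by blast
    \<comment> \<open>Each element of \<open>?V\<close> is \<open>S l\<close> applied to some
      \<open>Q *v u\<close> with \<open>u\<close> in \<open>U\<close>.\<close>
    then have "?V \<subseteq> range ((*v) (S l))"
      by (auto simp: matrix_image_eq_image simp flip: matrix_vector_mul_assoc)
    then show "matrix_image (S l) ?V = ?V"
      using symmetric_matrix_image_eq[OF sym[OF l] V] V_inv[OF l]
      by (simp add: matrix_image_eq_image)
  qed
  show "\<forall>W. shift_invariant_subspace_of d S U W \<and> (\<forall>l\<in>{1..d}. matrix_image (S l) W = W)
         \<longrightarrow> W \<subseteq> ?V"
  proof (intro allI impI, elim conjE)
    fix W assume "shift_invariant_subspace_of d S U W"
      and "\<forall>l\<in>{1..d}. matrix_image (S l) W = W"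
    then have "W \<subseteq> U" "matrix_image ?P W = W"
      by (auto simp: shift_invariant_subspace_of_def intro!: shift_product_image_eq)
    \<comment> \<open>Apply \<open>?P\<close> to both sides of \<open>W \<subseteq> U\<close>; the
      left side stays \<open>W\<close>.\<close>
    then show "W \<subseteq> ?V"
      using matrix_image_mono by metis
  qed
qed

end
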